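(* Let $Q_0,Q_1$ be probability measures on a measurable space $\mathbf{Z}$, and let $N_0,N_1$ be positive integers. Suppose that $Z_n$, $n=1,\dots,N_0$, are generated from $Q_0$, that $Z_n$, $n=N_0+1,\dots,N_0+N_1$, are generated from $Q_1$, all independently, and that the likelihood ratios $L_n$ are bounded: $0\le a\le L_n\le b<\infty$ for constants $a,b$. Suppose $\mathbb{E}_0L_n=1$ and $c:=\mathbb{E}_1L_n>1$. Then for any $\epsilon\in(0,1)$, with probability at least $1-\epsilon$, \[ \forall n\in\{1,\dots,N_1\}:\quad \ln\frac{L_{N_0+1}\cdots L_{N_0+n}}{E_{N_0+1}\cdots E_{N_0+n}} < \frac{n(n+1)}{N_0}\frac{c}{2} +\frac{n}{N_0^{1/2}}|b-a|\sqrt{\frac12\ln\frac2\epsilon} +\frac{(N_1+1)^{3/2}}{N_0}|b-a|\sqrt{\frac16\ln\frac2\epsilon}. \]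
   Context: Let $f_0$ and $f_1$ be probability densities of $Q_0$ and $Q_1$ with respect to a $\sigma$-finite measure $\mu$ on $\mathbf{Z}$ with respect to which both are absolutely continuous (such as $\mu=Q_0+Q_1$). The likelihood ratios are $L_n:=f_1(Z_n)/f_0(Z_n)$, $n=1,\dots,N_0+N_1$. $\mathbb{E}_0L_n$ and $\mathbb{E}_1L_n$ denote the expectation of $f_1(Z)/f_0(Z)$ when $Z\sim Q_0$ and $Z\sim Q_1$, respectively. (The condition $\mathbb{E}_0L_n=1$ means $Q_1\ll Q_0$, so $f_0(Z_n)>0$ almost surely for all $n$; the bounds on $L_n$ are understood almost surely.) The conformal e-values are the normalized likelihood ratios \[ E_n:=\frac{L_n}{\frac1n(L_1+\dots+L_n)}. \] Convention for zero values: each factor $L_m/E_m$ in the ratio is read as $\frac1m(L_1+\dots+L_m)$ (to which it is equal whenever $L_m>0$), and $\ln0:=-\infty$. *)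

theory Defs
  imports "HOL-Probability.Probability"
begin

(* Where f0 z = 0 the value is 0, by division by zero in HOL. Once the integral of the ratio
   under Q0 is 1, the set where f0 vanishes is null under both Q0 and Q1. *)
definition likelihood_ratio :: "('z \<Rightarrow> real) \<Rightarrow> ('z \<Rightarrow> real) \<Rightarrow> 'z \<Rightarrow> real" where
  "likelihood_ratio f0 f1 z = f1 z / f0 z"

(* The sequences L below are indexed from 1; L 0 is never used. *)
definition running_mean :: "(nat \<Rightarrow> real) \<Rightarrow> nat \<Rightarrow> real" where
  "running_mean L n = 1 / real n * (\<Sum>i = 1..n. L i)"

definition conformal_e_value :: "(nat \<Rightarrow> real) \<Rightarrow> nat \<Rightarrow> real" where
  "conformal_e_value L n = L n / running_mean L n"

(* The factor L m / E m, with the convention that it is read as the running mean when it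
   would be 0 / 0. *)
definition lr_over_e :: "(nat \<Rightarrow> real) \<Rightarrow> nat \<Rightarrow> real" where
  "lr_over_e L m =
     (if L m > 0 then L m / conformal_e_value L m else running_mean L m)"

lemma lr_over_e_eq_running_mean: "lr_over_e L m = running_mean L m"
  by (simp add: lr_over_e_def conformal_e_value_def)

(* The logarithm with ln 0 = -\<infinity>, unlike the real-valued ln, for which ln 0 = 0. *)
definition ext_ln :: "real \<Rightarrow> ereal" where
  "ext_ln x = (if x \<le> 0 then -\<infinity> else ereal (ln x))"

end

theory Submission
  imports Defs
begin

text \<open>Each factor \<open>L m / E m\<close> is a running mean. For \<open>m = N0 + j\<close> it is at most \<open>(S + T j) / N0\<close>, where
  \<open>S\<close> is the sum of the first \<open>N0\<close> likelihood ratios and \<open>T j\<close> that of the next \<open>j\<close>, and \<open>1 + x \<le> exp x\<close>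
  bounds the logarithm of the product by the sum of \<open>(S - N0 + T j) / N0\<close> over \<open>j \<le> n\<close>. Hoeffding's
  inequality controls \<open>S - N0\<close>. The sums over \<open>j \<le> n\<close> of the centred walk \<open>T j - c j\<close> are controlled
  for all \<open>n \<le> N1\<close> at once by a weighted maximal Hoeffding inequality, which costs \<open>\<epsilon> / 2\<close> like the first.\<close>

section \<open>Partial products stopped at a level\<close>

text \<open>Freezing the partial products at level \<open>u\<close> turns the event that some
  partial product reaches \<open>u\<close> into an event about the last index alone, so that
  Markov's inequality yields a maximal inequality. Values in \<open>ennreal\<close> avoid
  integrability conditions.\<close>

primrec stopped_prod :: "ennreal \<Rightarrow> (nat \<Rightarrow> ennreal) \<Rightarrow> nat \<Rightarrow> ennreal" where
  "stopped_prod u x 0 = 1"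
| "stopped_prod u x (Suc n) =
    (if u \<le> stopped_prod u x n then stopped_prod u x n else stopped_prod u x n * x (Suc n))"

lemma stopped_prod_cong:
  assumes "\<And>i. i \<in> {1..n} \<Longrightarrow> x i = y i"
  shows "stopped_prod u x n = stopped_prod u y n"
  using assms by (induction n) auto

lemma stopped_prod_mono:
  assumes "u \<le> stopped_prod u x k" "k \<le> n"
  shows "u \<le> stopped_prod u x n"
  using assms(2,1) by (induction rule: dec_induct) auto

lemma stopped_prod_eq_prod:
  assumes "\<And>k. k < n \<Longrightarrow> stopped_prod u x k < u"
  shows "stopped_prod u x n = (\<Prod>i=1..n. x i)"
  using assms
proof (induction n)
  case (Suc n)
  from Suc.prems[of n] have "\<not> u \<le> stopped_prod u x n"
    by (simp add: not_le)
  with Suc show ?case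
    by (simp add: mult.commute)
qed simp

lemma stopped_prod_ge:
  assumes "u \<le> (\<Prod>i=1..k. x i)" "k \<le> n"
  shows "u \<le> stopped_prod u x n"
proof (cases "\<exists>j<k. u \<le> stopped_prod u x j")
  case True
  then show ?thesis using stopped_prod_mono assms(2) by (meson less_imp_le order_trans)
next
  case False
  then have "stopped_prod u x k = (\<Prod>i=1..k. x i)"
    by (intro stopped_prod_eq_prod) (auto simp: not_le)
  with assms show ?thesis using stopped_prod_mono by metis
qed

lemma measurable_stopped_prod:
  assumes "\<And>i. i \<in> {1..n} \<Longrightarrow> (\<lambda>\<omega>. \<xi> i \<omega>) \<in> borel_measurable M"
  shows "(\<lambda>\<omega>. stopped_prod u (\<lambda>i. \<xi> i \<omega>) n) \<in> borel_measurable M"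
  using assms
proof (induction n)
  case (Suc n)
  then have [measurable]: "(\<lambda>\<omega>. stopped_prod u (\<lambda>i. \<xi> i \<omega>) n) \<in> borel_measurable M"
    "\<xi> (Suc n) \<in> borel_measurable M" by auto
  show ?case by simp
qed simp

section \<open>Maximal inequalities for independent factors and summands\<close>

context prob_space
begin

lemma indep_var_nn_integral_mult:
  fixes X Y :: "'a \<Rightarrow> ennreal"
  assumes "indep_var borel X borel Y"
  shows "(\<integral>\<^sup>+\<omega>. X \<omega> * Y \<omega> \<partial>M) = (\<integral>\<^sup>+\<omega>. X \<omega> \<partial>M) * (\<integral>\<^sup>+\<omega>. Y \<omega> \<partial>M)"
proof -
  \<comment> \<open>\<open>indep_var\<close> unfolds to the family of spaces
    \<open>case_bool borel borel\<close>, which has to be replaced by the constant family before the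
    product rule applies.\<close>
  have "indep_vars (\<lambda>_. borel) (case_bool X Y) UNIV"
    using assms unfolding indep_var_def
    by (rule iffD1[OF indep_vars_cong, rotated -1]) (auto split: bool.split)
  from indep_vars_nn_integral[OF _ this] show ?thesis
    by (simp add: UNIV_bool mult.commute)
qed

text \<open>This is the supermartingale property: a new factor multiplies only the part that is not
  yet frozen, is independent of that part, and has mean at most 1, so the total mean does not
  grow.\<close>

lemma nn_integral_stopped_prod_le:
  fixes \<xi> :: "nat \<Rightarrow> 'a \<Rightarrow> ennreal"
  assumes indep: "indep_vars (\<lambda>_. borel) \<xi> {1..n}"
    and le1: "\<And>i. i \<in> {1..n} \<Longrightarrow> (\<integral>\<^sup>+\<omega>. \<xi> i \<omega> \<partial>M) \<le> 1"
  shows "(\<integral>\<^sup>+\<omega>. stopped_prod u (\<lambda>i. \<xi> i \<omega>) n \<partial>M) \<le> 1"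
  using assms
proof (induction n)
  case (Suc n)
  let ?W = "\<lambda>\<omega>. stopped_prod u (\<lambda>i. \<xi> i \<omega>) n"
  \<comment> \<open>The unfrozen part, as a function of the tuple of factors. It depends only on the
    coordinates in \<open>{1..n}\<close>, which gives its independence from factor
    \<open>Suc n\<close>.\<close>
  let ?f = "\<lambda>x. if u \<le> stopped_prod u x n then 0 else stopped_prod u x n"
  have rv: "\<xi> i \<in> borel_measurable M" if "i \<in> {1..Suc n}" for i
    using Suc.prems(1) that by (auto simp: indep_vars_def)
  have [measurable]: "?W \<in> borel_measurable M" "\<xi> (Suc n) \<in> borel_measurable M"
    using rv by (auto intro!: measurable_stopped_prod)
  have "indep_var borel (?f \<circ> (\<lambda>\<omega>. restrict (\<lambda>i. \<xi> i \<omega>) {1..n}))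
      borel ((\<lambda>x. x (Suc n)) \<circ> (\<lambda>\<omega>. restrict (\<lambda>i. \<xi> i \<omega>) {Suc n}))"
  proof (rule indep_var_compose[OF indep_var_restrict[OF Suc.prems(1)]])
    have [measurable]: "(\<lambda>x. stopped_prod u x n) \<in> borel_measurable (Pi\<^sub>M {1..n} (\<lambda>_. borel))"
      by (intro measurable_stopped_prod) auto
    show "?f \<in> borel_measurable (Pi\<^sub>M {1..n} (\<lambda>_. borel))"
      by measurable
  qed auto
  moreover have "stopped_prod u (restrict (\<lambda>i. \<xi> i \<omega>) {1..n}) n = ?W \<omega>" for \<omega>
    by (rule stopped_prod_cong) auto
  ultimately have "indep_var borel (\<lambda>\<omega>. if u \<le> ?W \<omega> then 0 else ?W \<omega>) borel (\<xi> (Suc n))"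
    by (simp add: comp_def del: One_nat_def cong: if_cong)
  note prod_eq = indep_var_nn_integral_mult[OF this]
  have "(\<integral>\<^sup>+\<omega>. stopped_prod u (\<lambda>i. \<xi> i \<omega>) (Suc n) \<partial>M)
      = (\<integral>\<^sup>+\<omega>. (if u \<le> ?W \<omega> then ?W \<omega> else 0) + (if u \<le> ?W \<omega> then 0 else ?W \<omega>) * \<xi> (Suc n) \<omega> \<partial>M)"
    by (intro nn_integral_cong) auto
  also have "\<dots> = (\<integral>\<^sup>+\<omega>. (if u \<le> ?W \<omega> then ?W \<omega> else 0) \<partial>M)
      + (\<integral>\<^sup>+\<omega>. (if u \<le> ?W \<omega> then 0 else ?W \<omega>) \<partial>M) * (\<integral>\<^sup>+\<omega>. \<xi> (Suc n) \<omega> \<partial>M)"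
    by (subst nn_integral_add) (auto simp: prod_eq)
  also have "\<dots> \<le> (\<integral>\<^sup>+\<omega>. (if u \<le> ?W \<omega> then ?W \<omega> else 0) \<partial>M)
      + (\<integral>\<^sup>+\<omega>. (if u \<le> ?W \<omega> then 0 else ?W \<omega>) \<partial>M) * 1"
    using Suc.prems(2) by (intro add_left_mono mult_left_mono) auto
  also have "\<dots> = (\<integral>\<^sup>+\<omega>. (if u \<le> ?W \<omega> then ?W \<omega> else 0) + (if u \<le> ?W \<omega> then 0 else ?W \<omega>) \<partial>M)"
    by (subst nn_integral_add) auto
  also have "\<dots> = (\<integral>\<^sup>+\<omega>. ?W \<omega> \<partial>M)"
    by (intro nn_integral_cong) auto
  also have "\<dots> \<le> 1"
    using Suc.prems by (intro Suc.IH indep_vars_subset[OF Suc.prems(1)]) auto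
  finally show ?case .
qed (simp add: emeasure_space_1)

text \<open>A form of Ville's inequality: Markov's inequality is applied to the stopped product at
  the final index \<open>N\<close>.\<close>

lemma indep_prod_maximal_inequality:
  fixes \<xi> :: "nat \<Rightarrow> 'a \<Rightarrow> ennreal"
  assumes indep: "indep_vars (\<lambda>_. borel) \<xi> {1..N}"
    and le1: "\<And>i. i \<in> {1..N} \<Longrightarrow> (\<integral>\<^sup>+\<omega>. \<xi> i \<omega> \<partial>M) \<le> 1"
    and r: "r > 0"
  shows "prob {\<omega> \<in> space M. \<exists>n\<in>{1..N}. ennreal r \<le> (\<Prod>i=1..n. \<xi> i \<omega>)} \<le> 1 / r"
proof -
  let ?W = "\<lambda>\<omega>. stopped_prod (ennreal r) (\<lambda>i. \<xi> i \<omega>) N"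
  have [measurable]: "?W \<in> borel_measurable M"
    using indep by (intro measurable_stopped_prod) (auto simp: indep_vars_def)
  have W_ge: "1 \<le> ennreal (1 / r) * ?W \<omega>" if "ennreal r \<le> ?W \<omega>" for \<omega>
  proof -
    have "1 = ennreal (1 / r) * ennreal r"
      using r by (simp flip: ennreal_mult)
    also have "\<dots> \<le> ennreal (1 / r) * ?W \<omega>"
      using that by (intro mult_left_mono) auto
    finally show ?thesis .
  qed
  have "emeasure M {\<omega> \<in> space M. \<exists>n\<in>{1..N}. ennreal r \<le> (\<Prod>i=1..n. \<xi> i \<omega>)}
      \<le> emeasure M {\<omega> \<in> space M. 1 \<le> ennreal (1 / r) * ?W \<omega>}"
    by (intro emeasure_mono) (auto intro!: W_ge stopped_prod_ge)
  also have "\<dots> \<le> ennreal (1 / r) * (\<integral>\<^sup>+\<omega>. ?W \<omega> * indicator (space M) \<omega> \<partial>M)"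
    by (rule nn_integral_Markov_inequality) auto
  also have "(\<integral>\<^sup>+\<omega>. ?W \<omega> * indicator (space M) \<omega> \<partial>M) = (\<integral>\<^sup>+\<omega>. ?W \<omega> \<partial>M)"
    by (intro nn_integral_cong) auto
  also have "ennreal (1 / r) * \<dots> \<le> ennreal (1 / r) * 1"
    using nn_integral_stopped_prod_le[OF indep le1] by (intro mult_left_mono) auto
  finally show ?thesis
    using r by (simp add: emeasure_eq_measure)
qed

text \<open>The Chernoff argument with a running product in place of the final exponential. Asking
  only that \<open>V\<close> bound the sum of squares lets a closed form be inserted later.\<close>

theorem Hoeffding_maximal_inequality:
  fixes X :: "nat \<Rightarrow> 'a \<Rightarrow> real" and w :: "nat \<Rightarrow> real"
  assumes indep: "indep_vars (\<lambda>_. borel) X {1..N}"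
    and bounds: "\<And>i. i \<in> {1..N} \<Longrightarrow> AE \<omega> in M. X i \<omega> \<in> {a..b}"
    and w: "\<And>i. i \<in> {1..N} \<Longrightarrow> w i > 0"
    and V: "(\<Sum>i=1..N. (w i)\<^sup>2 * (b - a)\<^sup>2) \<le> V" "V > 0" and t: "t > 0"
  shows "prob {\<omega> \<in> space M. \<exists>n\<in>{1..N}. t \<le> (\<Sum>i=1..n. w i * (X i \<omega> - expectation (X i)))}
    \<le> exp (- 2 * t\<^sup>2 / V)"
proof -
  \<comment> \<open>The minimizer of \<open>l\<^sup>2 * V / 8 - l * t\<close>, whose minimum is
    \<open>- 2 * t\<^sup>2 / V\<close>.\<close>
  define l where "l = 4 * t / V"
  have l: "l > 0" using t V by (simp add: l_def)
  \<comment> \<open>The bound of Hoeffding's lemma on the log moment generating function of a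
    summand. Subtracting it in the exponent brings the mean of each \<open>\<xi> i\<close> down to
    at most 1.\<close>
  define d where "d i = l\<^sup>2 * ((w i)\<^sup>2 * (b - a)\<^sup>2) / 8" for i
  define \<xi> where "\<xi> i \<omega> = ennreal (exp (l * (w i * (X i \<omega> - expectation (X i))) - d i))" for i \<omega>
  have rv [measurable]: "X i \<in> borel_measurable M" if "i \<in> {1..N}" for i
    using indep that by (auto simp: indep_vars_def)
  have "indep_vars (\<lambda>_. borel) \<xi> {1..N}"
    unfolding \<xi>_def by (rule indep_vars_compose2[OF indep]) auto
  moreover have "(\<integral>\<^sup>+\<omega>. \<xi> i \<omega> \<partial>M) \<le> 1" if i: "i \<in> {1..N}" for i
  proof -
    interpret X: interval_bounded_random_variable M "X i" a b
      by unfold_locales (use i bounds in auto)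
    have "(\<integral>\<^sup>+\<omega>. \<xi> i \<omega> \<partial>M)
        = (\<integral>\<^sup>+\<omega>. ennreal (exp (- d i)) * ennreal (exp (l * w i * (X i \<omega> - expectation (X i)))) \<partial>M)"
      unfolding \<xi>_def by (intro nn_integral_cong) (simp add: mult.assoc flip: ennreal_mult exp_add)
    also have "\<dots> = ennreal (exp (- d i))
        * (\<integral>\<^sup>+\<omega>. ennreal (exp (l * w i * (X i \<omega> - expectation (X i)))) \<partial>M)"
      using rv[OF i] by (intro nn_integral_cmult) measurable
    also have "\<dots> \<le> ennreal (exp (- d i)) * ennreal (exp ((l * w i)\<^sup>2 * (b - a)\<^sup>2 / 8))"
      using l w[OF i] by (intro mult_left_mono X.Hoeffdings_lemma_nn_integral) auto
    also have "\<dots> = 1"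
      by (simp add: d_def power_mult_distrib mult.assoc flip: ennreal_mult exp_add)
    finally show ?thesis .
  qed
  ultimately have "prob {\<omega> \<in> space M. \<exists>n\<in>{1..N}. ennreal (exp (2 * t\<^sup>2 / V)) \<le> (\<Prod>i=1..n. \<xi> i \<omega>)}
      \<le> 1 / exp (2 * t\<^sup>2 / V)" (is "prob ?B \<le> _")
    by (rule indep_prod_maximal_inequality) auto
  moreover have "prob {\<omega> \<in> space M. \<exists>n\<in>{1..N}. t \<le> (\<Sum>i=1..n. w i * (X i \<omega> - expectation (X i)))}
      \<le> prob ?B" (is "prob ?A \<le> _")
  proof (rule finite_measure_mono)
    show "?A \<subseteq> ?B"
    proof safe
      fix \<omega> n assume n: "n \<in> {1..N}" and ge: "t \<le> (\<Sum>i=1..n. w i * (X i \<omega> - expectation (X i)))"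
      \<comment> \<open>The compensators up to \<open>n\<close> sum to at most the full budget
        \<open>l\<^sup>2 * V / 8\<close>, so a single \<open>l\<close> and a single level serve
        every \<open>n\<close>.\<close>
      have "(\<Sum>i=1..n. (w i)\<^sup>2 * (b - a)\<^sup>2) \<le> (\<Sum>i=1..N. (w i)\<^sup>2 * (b - a)\<^sup>2)"
        using n by (intro sum_mono2) auto
      then have "(\<Sum>i=1..n. d i) \<le> l\<^sup>2 * V / 8"
        using V(1) unfolding d_def
        by (simp flip: sum_divide_distrib sum_distrib_left add: mult_left_mono)
      moreover have "2 * t\<^sup>2 / V = l * t - l\<^sup>2 * V / 8"
        using V(2) by (simp add: l_def power2_eq_square field_simps)
      moreover have "l * t \<le> l * (\<Sum>i=1..n. w i * (X i \<omega> - expectation (X i)))"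
        using ge l by (intro mult_left_mono) auto
      ultimately have "2 * t\<^sup>2 / V
          \<le> (\<Sum>i=1..n. l * (w i * (X i \<omega> - expectation (X i))) - d i)"
        by (simp add: sum_subtractf sum_distrib_left)
      then have "ennreal (exp (2 * t\<^sup>2 / V)) \<le> (\<Prod>i=1..n. \<xi> i \<omega>)"
        unfolding \<xi>_def by (subst prod_ennreal) (auto simp flip: exp_sum)
      then show "\<exists>n\<in>{1..N}. ennreal (exp (2 * t\<^sup>2 / V)) \<le> (\<Prod>i=1..n. \<xi> i \<omega>)"
        using n by blast
    qed
    have [measurable]: "\<xi> i \<in> borel_measurable M" if "i \<in> {1..N}" for i
      unfolding \<xi>_def using rv[OF that] by measurable
    have "(\<lambda>\<omega>. \<Prod>i=1..n. \<xi> i \<omega>) \<in> borel_measurable M" if "n \<in> {1..N}" for n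
      using that by (intro borel_measurable_prod_ennreal) auto
    then show "?B \<in> events"
      by (intro sets.sets_Collect_finite_Ex) auto
  qed
  ultimately show ?thesis
    by (simp add: exp_minus inverse_eq_divide)
qed

end

section \<open>Pathwise bounds on the product of running means\<close>

text \<open>For \<open>x \<le> 0\<close> both sides are true, so a vanishing product needs no case
  of its own later on.\<close>

lemma ext_ln_less_ereal_iff: "ext_ln x < ereal B \<longleftrightarrow> x < exp B"
proof (cases "x \<le> 0")
  case True
  then show ?thesis
    using exp_gt_zero[of B] by (auto simp: ext_ln_def intro: le_less_trans)
next
  case False
  then have "ln x < B \<longleftrightarrow> x < exp B"
    by (metis exp_less_cancel_iff exp_ln not_le)
  with False show ?thesis by (simp add: ext_ln_def)
qed

text \<open>As sums of the \<open>y i\<close> with weights \<open>n + 1 - i\<close>, the iterated sums are no martingale. Those with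
  the weights \<open>N + 1 - i\<close> are, and they dominate whenever the plain sum of the \<open>y i\<close> is nonnegative;
  when it is negative, the iterated sum has just decreased.\<close>
lemma sum_weighted_less:
  fixes y :: "nat \<Rightarrow> real"
  assumes K: "\<And>n. n \<in> {1..N} \<Longrightarrow> (\<Sum>i=1..n. (real N + 1 - real i) * y i) < t"
    and t: "t > 0" and n: "n \<le> N"
  shows "(\<Sum>j=1..n. \<Sum>i=1..j. y i) < t"
  using n
proof (induction n)
  case (Suc n)
  let ?M = "\<lambda>n. \<Sum>j=1..n. \<Sum>i=1..j. y i"
  have M: "?M n = (\<Sum>i=1..n. (real n + 1 - real i) * y i)" for n
    by (induction n) (simp_all add: algebra_simps sum.distrib sum_subtractf sum_distrib_left)
  \<comment> \<open>Adding the partial sum \<open>N - m\<close> more times raises each weight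
    \<open>m + 1 - i\<close> to \<open>N + 1 - i\<close>.\<close>
  have "?M m + (real N - real m) * (\<Sum>i=1..m. y i) = (\<Sum>i=1..m. (real N + 1 - real i) * y i)" for m
    unfolding M by (simp add: sum_distrib_left algebra_simps flip: sum.distrib)
  from this[of "Suc n"] K[of "Suc n"] Suc.prems
  have "?M (Suc n) + (real N - real (Suc n)) * (\<Sum>i=1..Suc n. y i) < t" by simp
  moreover have "0 \<le> (real N - real (Suc n)) * (\<Sum>i=1..Suc n. y i)" if "0 \<le> (\<Sum>i=1..Suc n. y i)"
    using that Suc.prems by (intro mult_nonneg_nonneg) auto
  moreover have "?M (Suc n) = ?M n + (\<Sum>i=1..Suc n. y i)" by simp
  ultimately show ?case
    using Suc by fastforce
qed (use t in simp)

text \<open>The probability-free half of the argument, for one outcome outside both exceptional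
  events.\<close>

lemma prod_running_mean_less:
  fixes x :: "nat \<Rightarrow> real"
  assumes x: "\<And>i. i \<in> {1..N0 + N1} \<Longrightarrow> 0 \<le> x i" and N0: "N0 > 0"
    and S: "(\<Sum>i=1..N0. x i - 1) < s"
    and K: "\<And>n. n \<in> {1..N1} \<Longrightarrow> (\<Sum>i=1..n. (real N1 + 1 - real i) * (x (N0 + i) - c)) < t"
    and t: "t > 0" and n: "n \<in> {1..N1}"
  shows "(\<Prod>m=N0+1..N0+n. running_mean x m)
    < exp (real n * (real n + 1) / real N0 * (c / 2) + real n * s / real N0 + t / real N0)"
proof -
  \<comment> \<open>Each sum extends over the subtraction, so the first numerator is the sum of the
    first \<open>N0\<close> values minus \<open>N0\<close>. Hence \<open>1 + y j\<close> is the sum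
    up to \<open>N0 + j\<close> divided by \<open>N0\<close>.\<close>
  define y where "y j = (\<Sum>i=1..N0. x i - 1) / real N0 + (\<Sum>i=1..j. x (N0 + i)) / real N0" for j
  have mean_le: "0 \<le> running_mean x (j + N0) \<and> running_mean x (j + N0) \<le> exp (y j)"
    if j: "j \<in> {1..n}" for j
  proof -
    have split: "(\<Sum>i=1..j + N0. x i) = (\<Sum>i=1..N0. x i) + (\<Sum>i=1..j. x (N0 + i))"
      using sum.ub_add_nat[of 1 N0 x j] sum.shift_bounds_cl_nat_ivl[of x 1 N0 j]
      by (simp add: add.commute)
    have nonneg: "0 \<le> (\<Sum>i=1..j + N0. x i)"
      using j n by (intro sum_nonneg x) auto
    have "running_mean x (j + N0) = (\<Sum>i=1..j + N0. x i) / real (j + N0)"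
      by (simp add: running_mean_def)
    \<comment> \<open>Shrinking the denominator to \<open>N0\<close> makes the bound linear in the
      observations.\<close>
    also have "\<dots> \<le> (\<Sum>i=1..j + N0. x i) / real N0"
      using nonneg N0 by (intro divide_left_mono) auto
    also have "\<dots> = 1 + y j"
      using N0 by (simp add: y_def split sum_subtractf add_divide_distrib diff_divide_distrib del: One_nat_def)
    also have "\<dots> \<le> exp (y j)" by simp
    finally show ?thesis
      using nonneg by (auto simp: running_mean_def)
  qed
  have "(\<Prod>m=N0+1..N0+n. running_mean x m) = (\<Prod>j=1..n. running_mean x (j + N0))"
    using prod.shift_bounds_cl_nat_ivl[of "running_mean x" 1 N0 n] by (simp add: add.commute)
  also have "\<dots> \<le> (\<Prod>j=1..n. exp (y j))"
    using mean_le by (intro prod_mono) auto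
  also have "\<dots> = exp (\<Sum>j=1..n. y j)"
    by (simp add: exp_sum)
  also have "\<dots> < exp (real n * (real n + 1) / real N0 * (c / 2) + real n * s / real N0 + t / real N0)"
  proof -
    have "(\<Sum>j=1..n. \<Sum>i=1..j. x (N0 + i) - c) < t"
      using sum_weighted_less[OF K t] n by auto
    \<comment> \<open>The drift \<open>c * j\<close> summed over \<open>j \<le> n\<close> is the
      source of the term with \<open>c / 2\<close>.\<close>
    moreover have "(\<Sum>j=1..n. \<Sum>i=1..j. x (N0 + i) - c)
        = (\<Sum>j=1..n. \<Sum>i=1..j. x (N0 + i)) - real n * (real n + 1) * (c / 2)"
      by (induction n) (simp_all add: sum_subtractf field_simps)
    moreover have "real n * (\<Sum>i=1..N0. x i - 1) \<le> real n * s"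
      using S by (intro mult_left_mono) auto
    moreover have "(\<Sum>j=1..n. y j)
        = (real n * (\<Sum>i=1..N0. x i - 1) + (\<Sum>j=1..n. \<Sum>i=1..j. x (N0 + i))) / real N0"
      by (simp add: y_def sum.distrib add_divide_distrib flip: sum_divide_distrib)
    ultimately have "(\<Sum>j=1..n. y j) < (real n * (real n + 1) * (c / 2) + real n * s + t) / real N0"
      using N0 by (simp add: divide_strict_right_mono)
    then show ?thesis
      by (simp add: add_divide_distrib)
  qed
  finally show ?thesis .
qed

section \<open>Conformal e-values after a change point\<close>

theorem proposition8:
  fixes Q0 Q1 \<mu> :: "'z measure"
    and f0 f1 :: "'z \<Rightarrow> real"
    and P :: "'w measure"
    and Z :: "nat \<Rightarrow> 'w \<Rightarrow> 'z"
    and L :: "nat \<Rightarrow> 'w \<Rightarrow> real"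
    and N0 N1 :: nat
    and a b c \<epsilon> :: real
  assumes "prob_space Q0" and "prob_space Q1"
    and "sigma_finite_measure \<mu>"
    and "f0 \<in> borel_measurable \<mu>" and "f1 \<in> borel_measurable \<mu>"
    and "\<And>z. z \<in> space \<mu> \<Longrightarrow> 0 \<le> f0 z" and "\<And>z. z \<in> space \<mu> \<Longrightarrow> 0 \<le> f1 z"
    and "Q0 = density \<mu> (\<lambda>z. ennreal (f0 z))"
    and "Q1 = density \<mu> (\<lambda>z. ennreal (f1 z))"
    and "N0 > 0" and "N1 > 0"
    and "prob_space P"
    and "prob_space.indep_vars P (\<lambda>_. \<mu>) Z {1..N0 + N1}"
    and "\<And>n. n \<in> {1..N0} \<Longrightarrow> distr P \<mu> (Z n) = Q0"
    and "\<And>n. n \<in> {N0 + 1..N0 + N1} \<Longrightarrow> distr P \<mu> (Z n) = Q1"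
    and "\<And>n \<omega>. L n \<omega> = likelihood_ratio f0 f1 (Z n \<omega>)"
    and "0 \<le> a"
    and "\<And>n. n \<in> {1..N0 + N1} \<Longrightarrow> AE \<omega> in P. a \<le> L n \<omega> \<and> L n \<omega> \<le> b"
    and "(LINT z|Q0. likelihood_ratio f0 f1 z) = 1"
    and "c = (LINT z|Q1. likelihood_ratio f0 f1 z)" and "c > 1"
    and "0 < \<epsilon>" and "\<epsilon> < 1"
  shows "measure P {\<omega> \<in> space P. \<forall>n \<in> {1..N1}.
      ext_ln (\<Prod>m = N0 + 1..N0 + n. lr_over_e (\<lambda>i. L i \<omega>) m)
      < ereal (real n * (real n + 1) / real N0 * (c / 2)
          + real n / sqrt (real N0) * \<bar>b - a\<bar> * sqrt (1 / 2 * ln (2 / \<epsilon>))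
          + (real N1 + 1) powr (3 / 2) / real N0 * \<bar>b - a\<bar> * sqrt (1 / 6 * ln (2 / \<epsilon>)))}
    \<ge> 1 - \<epsilon>"
proof -
  interpret P: prob_space P by fact
  let ?lr = "likelihood_ratio f0 f1"
  have [measurable]: "?lr \<in> borel_measurable \<mu>"
    using assms(4,5) unfolding likelihood_ratio_def by measurable
  have Z [measurable]: "Z i \<in> measurable P \<mu>" if "i \<in> {1..N0 + N1}" for i
    using assms(13) that unfolding P.indep_vars_def by auto
  have L_eq: "L = (\<lambda>i \<omega>. ?lr (Z i \<omega>))"
    using assms(16) by auto
  have L_indep: "P.indep_vars (\<lambda>_. borel) L {1..N0 + N1}"
    unfolding L_eq by (rule P.indep_vars_compose2[OF assms(13)]) measurable
  have [measurable]: "L i \<in> borel_measurable P" if "i \<in> {1..N0 + N1}" for i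
    using L_indep that unfolding P.indep_vars_def by auto
  \<comment> \<open>The bounds by \<open>a\<close> and \<open>b\<close> hold only almost surely;
    nonnegativity at every outcome comes from the densities and serves the pathwise lemma.\<close>
  have L_nonneg: "0 \<le> L i \<omega>" if "i \<in> {1..N0 + N1}" "\<omega> \<in> space P" for i \<omega>
    using assms(6,7) measurable_space[OF Z[OF that(1)] that(2)]
    by (simp add: L_eq likelihood_ratio_def)
  have L_bounds: "AE \<omega> in P. L i \<omega> \<in> {a..b}" if "i \<in> {1..N0 + N1}" for i
    using assms(18)[OF that] by simp
  have E: "P.expectation (L i) = (LINT z|distr P \<mu> (Z i). ?lr z)" if "i \<in> {1..N0 + N1}" for i
    unfolding L_eq using that by (subst integral_distr) auto
  have E0: "P.expectation (L i) = 1" if "i \<in> {1..N0}" for i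
    using E[of i] assms(14,19) that by auto
  have E1: "P.expectation (L (N0 + i)) = c" if "i \<in> {1..N1}" for i
    using E[of "N0 + i"] assms(15)[of "N0 + i"] assms(20) that by auto
  have L_integrable: "integrable P (L i)" if i: "i \<in> {1..N0 + N1}" for i
  proof (rule P.integrable_const_bound)
    show "AE \<omega> in P. norm (L i \<omega>) \<le> b"
      using L_bounds[OF i] by eventually_elim (use \<open>0 \<le> a\<close> in auto)
  qed (use i in measurable)
  \<comment> \<open>The means 1 and \<open>c > 1\<close> both lie in the interval from
    \<open>a\<close> to \<open>b\<close>, which forces \<open>a < b\<close> and makes the variance
    bounds and thresholds positive.\<close>
  have "a \<le> P.expectation (L 1)"
    using L_bounds[of 1] L_integrable[of 1] \<open>N0 > 0\<close> by (intro P.integral_ge_const) auto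
  moreover have "P.expectation (L (N0 + 1)) \<le> b"
    using L_bounds[of "N0 + 1"] L_integrable[of "N0 + 1"] \<open>N1 > 0\<close>
    by (intro P.integral_le_const) auto
  ultimately have ab: "a < b"
    using E0[of 1] E1[of 1] \<open>N0 > 0\<close> \<open>N1 > 0\<close> \<open>c > 1\<close> by simp
  define lne where "lne = ln (2 / \<epsilon>)"
  have lne: "lne > 0"
    using \<open>0 < \<epsilon>\<close> \<open>\<epsilon> < 1\<close> by (simp add: lne_def)
  \<comment> \<open>Both thresholds make the Hoeffding exponent equal to
    \<open>- ln (2 / \<epsilon>)\<close>, so that each exceptional event has probability at most
    \<open>\<epsilon> / 2\<close>.\<close>
  define s where "s = sqrt (real N0) * \<bar>b - a\<bar> * sqrt (1 / 2 * lne)"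
  define t where "t = (real N1 + 1) powr (3 / 2) * \<bar>b - a\<bar> * sqrt (1 / 6 * lne)"
  have st: "s > 0" "t > 0"
    using ab lne \<open>N0 > 0\<close> by (simp_all add: s_def t_def)
  have exp_lne: "exp (- lne) = \<epsilon> / 2"
    using \<open>0 < \<epsilon>\<close> by (simp add: lne_def exp_minus)

  \<comment> \<open>The factor \<open>1\<close> matches the weights of the maximal inequality; the
    event is used below at \<open>n = N0\<close>.\<close>
  let ?A = "{\<omega> \<in> space P. \<exists>n\<in>{1..N0}. s \<le> (\<Sum>i=1..n. 1 * (L i \<omega> - P.expectation (L i)))}"
  let ?B = "{\<omega> \<in> space P. \<exists>n\<in>{1..N1}.
      t \<le> (\<Sum>i=1..n. (real N1 + 1 - real i) * (L (N0 + i) \<omega> - P.expectation (L (N0 + i))))}"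
  let ?bound = "\<lambda>n. real n * (real n + 1) / real N0 * (c / 2)
      + real n / sqrt (real N0) * \<bar>b - a\<bar> * sqrt (1 / 2 * ln (2 / \<epsilon>))
      + (real N1 + 1) powr (3 / 2) / real N0 * \<bar>b - a\<bar> * sqrt (1 / 6 * ln (2 / \<epsilon>))"
  let ?G = "{\<omega> \<in> space P. \<forall>n \<in> {1..N1}.
      ext_ln (\<Prod>m = N0 + 1..N0 + n. lr_over_e (\<lambda>i. L i \<omega>) m) < ereal (?bound n)}"

  have "P.prob ?A \<le> exp (- 2 * s\<^sup>2 / (real N0 * (b - a)\<^sup>2))"
    using ab st L_bounds \<open>N0 > 0\<close>
    by (intro P.Hoeffding_maximal_inequality[where a = a and b = b] P.indep_vars_subset[OF L_indep]) auto
  also have "- 2 * s\<^sup>2 / (real N0 * (b - a)\<^sup>2) = - lne"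
    using ab lne \<open>N0 > 0\<close> by (simp add: s_def power_mult_distrib)
  finally have A_le: "P.prob ?A \<le> \<epsilon> / 2"
    by (simp add: exp_lne)

  \<comment> \<open>Independence is carried to the shifted indices by restricting to the disjoint
    singletons \<open>{N0 + i}\<close>.\<close>
  have "P.indep_vars (\<lambda>i. Pi\<^sub>M {N0 + i} (\<lambda>_. borel))
      (\<lambda>i \<omega>. restrict (\<lambda>k. L k \<omega>) {N0 + i}) {1..N1}"
    by (rule P.indep_vars_restrict[OF L_indep]) (auto simp: disjoint_family_on_def)
  from P.indep_vars_compose2[OF this, of "\<lambda>i x. x (N0 + i)" "\<lambda>_. borel"]
  have "P.indep_vars (\<lambda>_. borel) (\<lambda>i. L (N0 + i)) {1..N1}"
    by simp
  \<comment> \<open>Reversed, the weights are \<open>1\<close> to \<open>N1\<close>, and the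
    integral of the square up to \<open>N1 + 1\<close> dominates their sum of squares. Hence the
    power \<open>3 / 2\<close> and the \<open>1 / 6\<close> in \<open>t\<close>.\<close>
  moreover have "(\<Sum>i=1..N1. (real N1 + 1 - real i)\<^sup>2 * (b - a)\<^sup>2) \<le> (real N1 + 1) ^ 3 / 3 * (b - a)\<^sup>2"
  proof -
    have "(\<Sum>i=1..N1. (real N1 + 1 - real i)\<^sup>2) = (\<Sum>i=1..N1. (real i)\<^sup>2)"
      by (rule sum.reindex_bij_witness[of _ "\<lambda>i. N1 + 1 - i" "\<lambda>i. N1 + 1 - i"]) (auto simp: of_nat_diff)
    also have "\<dots> \<le> (real N1 + 1) ^ 3 / 3"
      by (induction N1) (auto simp: power2_eq_square power3_eq_cube field_simps)
    finally show ?thesis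
      unfolding sum_distrib_right[symmetric] by (rule mult_right_mono) simp
  qed
  ultimately have "P.prob ?B \<le> exp (- 2 * t\<^sup>2 / ((real N1 + 1) ^ 3 / 3 * (b - a)\<^sup>2))"
    using ab st L_bounds
    by (intro P.Hoeffding_maximal_inequality[where a = a and b = b]) auto
  also have "- 2 * t\<^sup>2 / ((real N1 + 1) ^ 3 / 3 * (b - a)\<^sup>2) = - lne"
  proof -
    have "((real N1 + 1) powr (3 / 2))\<^sup>2 = (real N1 + 1) powr (3 / 2 * 2)"
      by (subst powr_powr[symmetric]) (simp add: powr_numeral)
    also have "\<dots> = (real N1 + 1) ^ 3"
      by (simp add: powr_numeral)
    finally show ?thesis
      using ab lne by (simp add: t_def power_mult_distrib)
  qed
  finally have B_le: "P.prob ?B \<le> \<epsilon> / 2"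
    by (simp add: exp_lne)

  have A_meas: "?A \<in> P.events"
  proof (intro sets.sets_Collect_finite_Ex)
    fix n assume "n \<in> {1..N0}"
    then have "(\<lambda>\<omega>. \<Sum>i=1..n. 1 * (L i \<omega> - P.expectation (L i))) \<in> borel_measurable P"
      by (intro borel_measurable_sum borel_measurable_times borel_measurable_diff) auto
    then show "{\<omega> \<in> space P. s \<le> (\<Sum>i=1..n. 1 * (L i \<omega> - P.expectation (L i)))} \<in> P.events"
      by simp
  qed simp
  have B_meas: "?B \<in> P.events"
  proof (intro sets.sets_Collect_finite_Ex)
    fix n assume "n \<in> {1..N1}"
    then have "(\<lambda>\<omega>. \<Sum>i=1..n. (real N1 + 1 - real i) * (L (N0 + i) \<omega> - P.expectation (L (N0 + i))))
        \<in> borel_measurable P"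
      by (intro borel_measurable_sum borel_measurable_times borel_measurable_diff) auto
    then show "{\<omega> \<in> space P.
        t \<le> (\<Sum>i=1..n. (real N1 + 1 - real i) * (L (N0 + i) \<omega> - P.expectation (L (N0 + i))))} \<in> P.events"
      by simp
  qed simp
  have good: "\<omega> \<in> ?G" if \<omega>: "\<omega> \<in> space P" "\<omega> \<notin> ?A" "\<omega> \<notin> ?B" for \<omega>
  proof -
    have "ext_ln (\<Prod>m = N0 + 1..N0 + n. lr_over_e (\<lambda>i. L i \<omega>) m) < ereal (?bound n)"
      if n: "n \<in> {1..N1}" for n
    proof -
      have "(\<Prod>m=N0+1..N0+n. running_mean (\<lambda>i. L i \<omega>) m)
          < exp (real n * (real n + 1) / real N0 * (c / 2) + real n * s / real N0 + t / real N0)"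
      proof (rule prod_running_mean_less)
        have "\<not> s \<le> (\<Sum>i=1..N0. 1 * (L i \<omega> - P.expectation (L i)))"
          using \<omega> \<open>N0 > 0\<close> by auto
        then show "(\<Sum>i=1..N0. L i \<omega> - 1) < s"
          using E0 by (simp add: not_le)
        fix k assume k: "k \<in> {1..N1}"
        have "\<not> t \<le> (\<Sum>i=1..k. (real N1 + 1 - real i) * (L (N0 + i) \<omega> - P.expectation (L (N0 + i))))"
          using \<omega> k by auto
        then show "(\<Sum>i=1..k. (real N1 + 1 - real i) * (L (N0 + i) \<omega> - c)) < t"
          using E1 k by (simp add: not_le)
      qed (use L_nonneg \<omega> st n \<open>N0 > 0\<close> in auto)
      moreover have "real n * s / real N0 = real n / sqrt (real N0) * \<bar>b - a\<bar> * sqrt (1 / 2 * lne)"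
        using \<open>N0 > 0\<close> by (simp add: s_def field_simps)
      moreover have "t / real N0 = (real N1 + 1) powr (3 / 2) / real N0 * \<bar>b - a\<bar> * sqrt (1 / 6 * lne)"
        by (simp add: t_def)
      ultimately show ?thesis
        by (simp add: lr_over_e_eq_running_mean ext_ln_less_ereal_iff lne_def)
    qed
    with \<omega> show ?thesis by blast
  qed
  \<comment> \<open>Monotonicity of \<open>measure\<close> requires the larger set to be measurable;
    this is seen once the extended logarithm is rewritten as a comparison of reals.\<close>
  have G_meas: "?G \<in> P.events"
  proof -
    have "(\<lambda>\<omega>. \<Prod>m=N0+1..N0+n. running_mean (\<lambda>i. L i \<omega>) m) \<in> borel_measurable P"
      if "n \<in> {1..N1}" for n
      unfolding running_mean_def using that
      by (intro borel_measurable_prod borel_measurable_times borel_measurable_sum) auto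
    then show ?thesis
      unfolding lr_over_e_eq_running_mean ext_ln_less_ereal_iff
      by (intro sets.sets_Collect_finite_All) auto
  qed
  have "1 - P.prob (?A \<union> ?B) = P.prob (space P - (?A \<union> ?B))"
    using A_meas B_meas by (subst P.prob_compl) auto
  also have "\<dots> \<le> P.prob ?G"
    using good by (intro P.finite_measure_mono[OF _ G_meas]) blast
  finally show ?thesis
    using measure_Un_le[OF A_meas B_meas] A_le B_le by linarith
qed

end
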